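(* There exist an integer $k\ge 1$, an interlaced symmetric word $S=S(X,B_1,\ldots,B_k)$ of degree $6$, $3\times 3$ positive definite matrices $B_1,\ldots,B_k$, and a $3\times 3$ positive semidefinite matrix $P$ such that the symmetric word equation $S(X,B_1,\ldots,B_k)=P$ has at least two distinct solutions $X$ that are real $3\times 3$ positive definite matrices.
   Context: A matrix is positive definite (resp. positive semidefinite) if it is complex Hermitian with all eigenvalues positive (resp. nonnegative); a real one is in particular symmetric. Words are elements of the free monoid on the letters $X,B_1,\ldots,B_k$. A word is symmetric if it equals its reversal (palindrome). A word is interlaced if it has the form $W=B_{i_1}^{q_1}\prod_{j=1}^{m}X^{p_j}B_{i_{j+1}}^{q_{j+1}}$ with $m\ge 1$, integers $p_j>0$, $q_j\ge 0$ and indices $i_j\in\{1,\ldots,k\}$ (the zeroth power of a letter is the empty word); its degree is $p_1+\cdots+p_m$, i.e. the number of occurrences of $X$. For matrices, $S(X,B_1,\ldots,B_k)$ denotes the matrix product obtained by substituting the matrices for the letters. A symmetric word equation is an equation $S(X,B_1,\ldots,B_k)=P$ with $S$ an interlaced symmetric word, $B_i$ positive definite, $P$ positive semidefinite; a solution is a positive semidefinite $X$ satisfying it. *)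

theory Defs
  imports Complex_Main "Jordan_Normal_Form.Char_Poly" "Jordan_Normal_Form.Schur_Decomposition"
begin

definition hermitian_mat :: "complex mat \<Rightarrow> bool" where
  "hermitian_mat A \<longleftrightarrow> square_mat A \<and> mat_adjoint A = A"

definition positive_definite :: "complex mat \<Rightarrow> bool" where
  "positive_definite A \<longleftrightarrow> hermitian_mat A \<and> (\<forall>c. eigenvalue A c \<longrightarrow> c \<in> \<real> \<and> 0 < Re c)"

definition positive_semidefinite :: "complex mat \<Rightarrow> bool" where
  "positive_semidefinite A \<longleftrightarrow> hermitian_mat A \<and> (\<forall>c. eigenvalue A c \<longrightarrow> c \<in> \<real> \<and> 0 \<le> Re c)"

definition real_mat :: "complex mat \<Rightarrow> bool" where
  "real_mat A \<longleftrightarrow> elements_mat A \<subseteq> \<real>"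

datatype letter = LX | LB nat

(* The free monoid on the letters is the type of lists, with concatenation as product. *)
type_synonym word = "letter list"

definition symmetric_word :: "word \<Rightarrow> bool" where
  "symmetric_word W \<longleftrightarrow> rev W = W"

(* W = B_{i 1}^{q 1} X^{p 1} B_{i 2}^{q 2} ... X^{p m} B_{i (m+1)}^{q (m+1)} *)
definition interlaced :: "nat \<Rightarrow> word \<Rightarrow> bool" where
  "interlaced k W \<longleftrightarrow>
    (\<exists>(m::nat) (p::nat \<Rightarrow> nat) (q::nat \<Rightarrow> nat) (i::nat \<Rightarrow> nat).
      1 \<le> m \<and>
      (\<forall>j\<in>{1..m}. 0 < p j) \<and>
      (\<forall>j\<in>{1..m+1}. i j \<in> {1..k}) \<and>
      W = replicate (q 1) (LB (i 1)) @
          concat (map (\<lambda>j. replicate (p j) LX @ replicate (q (j+1)) (LB (i (j+1)))) [1..<m+1]))"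

definition word_degree :: "word \<Rightarrow> nat" where
  "word_degree W = count_list W LX"

fun letter_mat :: "complex mat \<Rightarrow> (nat \<Rightarrow> complex mat) \<Rightarrow> letter \<Rightarrow> complex mat" where
  "letter_mat X B LX = X"
| "letter_mat X B (LB i) = B i"

(* The dimension n is needed only to interpret the empty word as the identity matrix. *)
fun word_mat :: "nat \<Rightarrow> word \<Rightarrow> complex mat \<Rightarrow> (nat \<Rightarrow> complex mat) \<Rightarrow> complex mat" where
  "word_mat n [] X B = 1\<^sub>m n"
| "word_mat n (a # W) X B = letter_mat X B a * word_mat n W X B"

(* Only B 1, ..., B k are constrained; an interlaced word over k letters uses no other B i. *)
definition symmetric_word_equation ::
    "nat \<Rightarrow> nat \<Rightarrow> word \<Rightarrow> (nat \<Rightarrow> complex mat) \<Rightarrow> complex mat \<Rightarrow> bool" where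
  "symmetric_word_equation n k S B P \<longleftrightarrow>
    interlaced k S \<and> symmetric_word S \<and>
    (\<forall>i\<in>{1..k}. B i \<in> carrier_mat n n \<and> positive_definite (B i)) \<and>
    P \<in> carrier_mat n n \<and> positive_semidefinite P"

definition is_solution ::
    "nat \<Rightarrow> word \<Rightarrow> (nat \<Rightarrow> complex mat) \<Rightarrow> complex mat \<Rightarrow> complex mat \<Rightarrow> bool" where
  "is_solution n S B P X \<longleftrightarrow>
    X \<in> carrier_mat n n \<and> positive_semidefinite X \<and> word_mat n S X B = P"

end

theory Submission
  imports Defs
begin

text \<open>
  In the word \<open>X B\<^sub>1 X B\<^sub>2 X B\<^sub>3 X B\<^sub>2 X B\<^sub>1 X\<close> the letter \<open>B\<^sub>3\<close> enters linearly: writing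
  \<open>M(X) = X B\<^sub>1 X B\<^sub>2 X\<close>, the value is \<open>M(X) B\<^sub>3 M(X)\<^sup>*\<close>. Hence \<open>X\<close> and \<open>Y\<close> give the same value iff
  \<open>G = M(Y)\<^sup>-\<^sup>1 M(X)\<close> satisfies \<open>G B\<^sub>3 G\<^sup>* = B\<^sub>3\<close>, which has a positive definite solution \<open>B\<^sub>3\<close> as soon
  as \<open>G\<close> is diagonalizable with spectrum on the unit circle. Take \<open>X = 6 I\<close> and
  \<open>Y = diag(4, 6, 9)\<close>, and let \<open>J\<close> be the permutation matrix exchanging the first and third
  coordinates, so that \<open>J (Y/6) J = (Y/6)\<^sup>-\<^sup>1\<close>. The choice \<open>B\<^sub>2 = J B\<^sub>1\<^sup>-\<^sup>1 J\<close>, up to a scalar, makes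
  the spectrum of \<open>G\<close> invariant under inversion, so that it remains to have \<open>-1 < tr G < 3\<close>.
  A search over small integer matrices \<open>B\<^sub>1\<close> then yields the witnesses below.
\<close>

text \<open>Entries are real and embedded into the complex numbers entrywise, so products of
  witnesses reduce to real arithmetic and realness is automatic.\<close>

definition mat3 ::
    "real \<Rightarrow> real \<Rightarrow> real \<Rightarrow> real \<Rightarrow> real \<Rightarrow> real \<Rightarrow> real \<Rightarrow> real \<Rightarrow> real \<Rightarrow> complex mat" where
  "mat3 a b c d e f g h i =
    mat_of_rows_list 3 (map (map complex_of_real) [[a, b, c], [d, e, f], [g, h, i]])"

lemma mat3_carrier [simp]: "mat3 a b c d e f g h i \<in> carrier_mat 3 3"
  by (rule carrier_matI) (simp_all add: mat3_def mat_of_rows_list_def)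

lemma mat3_dim [simp]:
  "dim_row (mat3 a b c d e f g h i) = 3" "dim_col (mat3 a b c d e f g h i) = 3"
  by (simp_all add: mat3_def mat_of_rows_list_def)

lemma mat3_index [simp]:
  "mat3 a b c d e f g h i $$ (0, 0) = complex_of_real a"
  "mat3 a b c d e f g h i $$ (0, Suc 0) = complex_of_real b"
  "mat3 a b c d e f g h i $$ (0, 2) = complex_of_real c"
  "mat3 a b c d e f g h i $$ (Suc 0, 0) = complex_of_real d"
  "mat3 a b c d e f g h i $$ (Suc 0, Suc 0) = complex_of_real e"
  "mat3 a b c d e f g h i $$ (Suc 0, 2) = complex_of_real f"
  "mat3 a b c d e f g h i $$ (2, 0) = complex_of_real g"
  "mat3 a b c d e f g h i $$ (2, Suc 0) = complex_of_real h"
  "mat3 a b c d e f g h i $$ (2, 2) = complex_of_real i"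
  by (simp_all add: mat3_def mat_of_rows_list_def)

lemma all_less_3_iff: "(\<forall>i<3::nat. Q i) \<longleftrightarrow> Q 0 \<and> Q 1 \<and> Q 2"
  by (auto simp: numeral_3_eq_3 numeral_2_eq_2 less_Suc_eq)

lemma eq_mat3I:
  assumes "A \<in> carrier_mat 3 3" "B \<in> carrier_mat 3 3"
    and "\<forall>i<3. \<forall>j<3. A $$ (i, j) = B $$ (i, j)"
  shows "A = B"
  using assms by (intro eq_matI) auto

lemma sum_atLeast0_lessThan_3: "sum f {0..<3::nat} = f 0 + f 1 + f 2"
  by (simp add: numeral_3_eq_3 numeral_2_eq_2)

text \<open>Keeps products in \<open>mat3\<close> form, so that simplification can evaluate a whole
  word.\<close>

lemma mat3_mult:
  "mat3 a b c d e f g h i * mat3 a' b' c' d' e' f' g' h' i' =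
    mat3 (a * a' + b * d' + c * g') (a * b' + b * e' + c * h') (a * c' + b * f' + c * i')
      (d * a' + e * d' + f * g') (d * b' + e * e' + f * h') (d * c' + e * f' + f * i')
      (g * a' + h * d' + i * g') (g * b' + h * e' + i * h') (g * c' + h * f' + i * i')"
proof (rule eq_mat3I)
  let ?A = "mat3 a b c d e f g h i" and ?B = "mat3 a' b' c' d' e' f' g' h' i'"
  have "(?A * ?B) $$ (k, l) = (\<Sum>m\<in>{0..<3}. ?A $$ (k, m) * ?B $$ (m, l))"
    if "k < 3" "l < 3" for k l
    using that by (simp add: scalar_prod_def)
  then show "\<forall>k<3. \<forall>l<3. (?A * ?B) $$ (k, l) = mat3
      (a * a' + b * d' + c * g') (a * b' + b * e' + c * h') (a * c' + b * f' + c * i')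
      (d * a' + e * d' + f * g') (d * b' + e * e' + f * h') (d * c' + e * f' + f * i')
      (g * a' + h * d' + i * g') (g * b' + h * e' + i * h') (g * c' + h * f' + i * i') $$ (k, l)"
    by (simp add: sum_atLeast0_lessThan_3 all_less_3_iff)
qed (auto intro: mult_carrier_mat)

lemma one_mat3: "1\<^sub>m 3 = mat3 1 0 0 0 1 0 0 0 1"
  by (rule eq_mat3I) (auto simp: all_less_3_iff)

abbreviation sym3 :: "real \<Rightarrow> real \<Rightarrow> real \<Rightarrow> real \<Rightarrow> real \<Rightarrow> real \<Rightarrow> complex mat" where
  "sym3 p q r s t u \<equiv> mat3 p q r q s t r t u"

lemma real_mat_mat3: "real_mat (mat3 a b c d e f g h i)"
proof -
  have "\<forall>k<3. \<forall>l<3. mat3 a b c d e f g h i $$ (k, l) \<in> \<real>"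
    by (simp add: all_less_3_iff)
  then show ?thesis
    by (auto simp: real_mat_def elements_mat_def)
qed

lemma mat_adjoint_carrier: "A \<in> carrier_mat m n \<Longrightarrow> mat_adjoint A \<in> carrier_mat n m"
  by (rule carrier_matI) (simp_all add: mat_adjoint_def)

lemma index_mat_adjoint:
  "i < dim_col A \<Longrightarrow> j < dim_row A \<Longrightarrow> mat_adjoint A $$ (i, j) = conjugate (A $$ (j, i))"
  by (simp add: mat_adjoint_def mat_of_rows_index)

lemma hermitian_mat_sym3: "hermitian_mat (sym3 p q r s t u)"
  unfolding hermitian_mat_def
proof
  show "mat_adjoint (sym3 p q r s t u) = sym3 p q r s t u"
    by (intro eq_mat3I mat_adjoint_carrier mat3_carrier) (simp add: all_less_3_iff index_mat_adjoint)
qed simp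

text \<open>Lagrange reduction: completing squares gives a sum of squares weighted by the leading
  principal minors.\<close>

lemma quadratic_form3_pos:
  fixes p q r s t u x y z :: real
  assumes p: "0 < p" and d2: "0 < p * s - q\<^sup>2"
    and d3: "0 < p * s * u + 2 * q * r * t - p * t\<^sup>2 - s * r\<^sup>2 - u * q\<^sup>2"
    and nz: "x \<noteq> 0 \<or> y \<noteq> 0 \<or> z \<noteq> 0"
  shows "0 < p * x\<^sup>2 + s * y\<^sup>2 + u * z\<^sup>2 + 2 * q * x * y + 2 * r * x * z + 2 * t * y * z"
    (is "0 < ?Q")
proof -
  define d2 where "d2 = p * s - q\<^sup>2"
  define d3 where "d3 = p * s * u + 2 * q * r * t - p * t\<^sup>2 - s * r\<^sup>2 - u * q\<^sup>2"
  define a b where "a = p * x + q * y + r * z" and "b = d2 * y + (p * t - q * r) * z"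
  have pos: "0 < d2" "0 < d3" using assms by (simp_all add: d2_def d3_def)
  have eq: "p * d2 * ?Q = d2 * a\<^sup>2 + b\<^sup>2 + p * d3 * z\<^sup>2"
    unfolding a_def b_def d2_def d3_def by (simp add: power2_eq_square algebra_simps)
  \<comment> \<open>The change of variables to \<open>a\<close>, \<open>b\<close>, \<open>z\<close>
    is triangular with diagonal \<open>p\<close>, \<open>d2\<close>, \<open>1\<close>, hence
    injective.\<close>
  have "a \<noteq> 0 \<or> b \<noteq> 0 \<or> z \<noteq> 0"
    using nz p pos by (auto simp: a_def b_def)
  have "0 < d2 * a\<^sup>2 + b\<^sup>2 + p * d3 * z\<^sup>2"
  proof -
    have "0 \<le> d2 * a\<^sup>2" "0 \<le> b\<^sup>2" "0 \<le> p * d3 * z\<^sup>2" using p pos by simp_all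
    moreover have "a \<noteq> 0 \<Longrightarrow> 0 < d2 * a\<^sup>2" "b \<noteq> 0 \<Longrightarrow> 0 < b\<^sup>2"
      "z \<noteq> 0 \<Longrightarrow> 0 < p * d3 * z\<^sup>2" using p pos by simp_all
    ultimately show ?thesis using \<open>a \<noteq> 0 \<or> b \<noteq> 0 \<or> z \<noteq> 0\<close> by linarith
  qed
  with eq have "0 < (p * d2) * ?Q" by simp
  moreover have "0 < p * d2" using p pos by simp
  ultimately show ?thesis by (rule zero_less_mult_pos)
qed

text \<open>Sylvester's criterion. For an eigenvector \<open>v\<close> of the matrix
  \<open>A\<close>, \<open>v^* A v = c |v|^2\<close>; the left side is the real form at
  \<open>Re v\<close> plus the form at \<open>Im v\<close>, hence real and positive.\<close>

lemma positive_definite_sym3: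
  assumes p: "0 < p" and d2: "0 < p * s - q\<^sup>2"
    and d3: "0 < p * s * u + 2 * q * r * t - p * t\<^sup>2 - s * r\<^sup>2 - u * q\<^sup>2"
  shows "positive_definite (sym3 p q r s t u)"
  unfolding positive_definite_def
proof (intro conjI allI impI hermitian_mat_sym3)
  fix c assume "eigenvalue (sym3 p q r s t u) c"
  then obtain v where v: "v \<in> carrier_vec 3" "v \<noteq> 0\<^sub>v 3"
    and ev: "sym3 p q r s t u *\<^sub>v v = c \<cdot>\<^sub>v v"
    by (auto simp: eigenvalue_def eigenvector_def)
  define x y z where "x = v $ 0" and "y = v $ 1" and "z = v $ 2"
  have row: "(sym3 p q r s t u *\<^sub>v v) $ i = c * v $ i" if "i < 3" for i
    using that v by (simp add: ev)
  have e: "p * x + q * y + r * z = c * x" "q * x + s * y + t * z = c * y"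
    "r * x + t * y + u * z = c * z"
    using row[of 0] row[of 1] row[of 2] v
    by (simp_all add: x_def y_def z_def scalar_prod_def sum_atLeast0_lessThan_3)
  have nz: "x \<noteq> 0 \<or> y \<noteq> 0 \<or> z \<noteq> 0"
  proof (rule ccontr)
    assume "\<not> ?thesis"
    then have "v = 0\<^sub>v 3"
      using v all_less_3_iff[of "\<lambda>i. v $ i = 0"]
      by (intro eq_vecI) (auto simp: x_def y_def z_def)
    with v show False by simp
  qed
  define Q where "Q = (\<lambda>x y z :: real.
    p * x\<^sup>2 + s * y\<^sup>2 + u * z\<^sup>2 + 2 * q * x * y + 2 * r * x * z + 2 * t * y * z)"
  define N where "N = (Re x)\<^sup>2 + (Im x)\<^sup>2 + (Re y)\<^sup>2 + (Im y)\<^sup>2 + (Re z)\<^sup>2 + (Im z)\<^sup>2"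
  have Qpos: "0 < Q a b c" if "a \<noteq> 0 \<or> b \<noteq> 0 \<or> c \<noteq> 0" for a b c
    unfolding Q_def using quadratic_form3_pos[OF p d2 d3 that] .
  have Q0: "Q 0 0 0 = 0" by (simp add: Q_def)
  have "0 \<le> Q (Re x) (Re y) (Re z)" "0 \<le> Q (Im x) (Im y) (Im z)"
    using Qpos Q0 by (metis less_eq_real_def)+
  moreover have "0 < Q (Re x) (Re y) (Re z) \<or> 0 < Q (Im x) (Im y) (Im z)"
    using nz Qpos by (metis complex_eq_iff zero_complex.sel)
  ultimately have Q: "0 < Q (Re x) (Re y) (Re z) + Q (Im x) (Im y) (Im z)" by linarith
  have re: "p * Re x + q * Re y + r * Re z = Re c * Re x - Im c * Im x"
    "q * Re x + s * Re y + t * Re z = Re c * Re y - Im c * Im y"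
    "r * Re x + t * Re y + u * Re z = Re c * Re z - Im c * Im z"
    using e[THEN arg_cong[where f = Re]] by simp_all
  have im: "p * Im x + q * Im y + r * Im z = Re c * Im x + Im c * Re x"
    "q * Im x + s * Im y + t * Im z = Re c * Im y + Im c * Re y"
    "r * Im x + t * Im y + u * Im z = Re c * Im z + Im c * Re z"
    using e[THEN arg_cong[where f = Im]] by simp_all
  have "Q (Re x) (Re y) (Re z) + Q (Im x) (Im y) (Im z) =
      Re x * (p * Re x + q * Re y + r * Re z) + Im x * (p * Im x + q * Im y + r * Im z) +
      Re y * (q * Re x + s * Re y + t * Re z) + Im y * (q * Im x + s * Im y + t * Im z) +
      Re z * (r * Re x + t * Re y + u * Re z) + Im z * (r * Im x + t * Im y + u * Im z)"
    unfolding Q_def by (simp add: power2_eq_square algebra_simps)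
  also have "\<dots> = Re c * N"
    unfolding re im N_def by (simp add: power2_eq_square algebra_simps)
  finally have QN: "Q (Re x) (Re y) (Re z) + Q (Im x) (Im y) (Im z) = Re c * N" .
  \<comment> \<open>The right side is the imaginary part of \<open>v^* A v\<close>; it vanishes by
    symmetry of the matrix.\<close>
  have "0 =
      (Re x * (p * Im x + q * Im y + r * Im z) - Im x * (p * Re x + q * Re y + r * Re z)) +
      (Re y * (q * Im x + s * Im y + t * Im z) - Im y * (q * Re x + s * Re y + t * Re z)) +
      (Re z * (r * Im x + t * Im y + u * Im z) - Im z * (r * Re x + t * Re y + u * Re z))"
    by (simp add: algebra_simps)
  also have "\<dots> = Im c * N"
    unfolding re im N_def by (simp add: power2_eq_square algebra_simps)
  finally have "Im c * N = 0" by simp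
  moreover have "0 \<le> N" by (simp add: N_def)
  moreover have "N \<noteq> 0" using Q QN by auto
  ultimately show "c \<in> \<real>" "0 < Re c"
    using Q QN by (auto simp: complex_is_Real_iff zero_less_mult_iff)
qed

lemma positive_definite_imp_semidefinite:
  "positive_definite A \<Longrightarrow> positive_semidefinite A"
  by (auto simp: positive_definite_def positive_semidefinite_def less_imp_le)

text \<open>The second matrix is \<open>3 J B_1^-1 J\<close>; the third solves
  \<open>M(X) B_3 M(X)^* = M(Y) B_3 M(Y)^*\<close>. It also fills all other indices, so every
  \<open>wit_B i\<close> is positive definite.\<close>

definition wit_B :: "nat \<Rightarrow> complex mat" where
  "wit_B i = (if i = 1 then sym3 7 5 0 4 0 1
    else if i = 2 then sym3 3 0 0 7 (-5) 4
    else sym3 360 (-495) (-349) 712 520 390)"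

text \<open>This is \<open>6^6 B_1 B_2 B_3 B_2 B_1\<close>, the value of the word at
  \<open>X = 6 I\<close>.\<close>

definition wit_P :: "complex mat" where
  "wit_P = sym3 163762560 218350080 (-146546496) 298971648 (-207852480) 151165440"

definition wit_word :: word where
  "wit_word = [LX, LB 1, LX, LB 2, LX, LB 3, LX, LB 2, LX, LB 1, LX]"

lemma interlaced_wit_word: "interlaced 3 wit_word"
proof -
  \<comment> \<open>The word starts and ends with \<open>LX\<close>, so the outer exponents are 0;
    their indices must still lie in range and default to 1.\<close>
  let ?q = "\<lambda>j::nat. if j = 1 \<or> j = 7 then 0 else 1::nat"
  let ?i = "\<lambda>j::nat. if j = 3 \<or> j = 5 then 2 else if j = 4 then 3 else 1::nat"
  show ?thesis
    unfolding interlaced_def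
    by (rule exI[of _ 6], rule exI[of _ "\<lambda>_. 1"], rule exI[of _ ?q], rule exI[of _ ?i])
      (simp add: wit_word_def upt_rec)
qed

text \<open>Exact evaluation; \<open>one_mat3\<close> handles the empty word that ends the
  recursion.\<close>

lemma word_mat_wit:
  "word_mat 3 wit_word (sym3 6 0 0 6 0 6) wit_B = wit_P"
  "word_mat 3 wit_word (sym3 4 0 0 6 0 9) wit_B = wit_P"
  unfolding wit_word_def wit_B_def wit_P_def
  by (simp_all add: mat3_mult one_mat3)

theorem theorem1p4:
  shows "\<exists>(k::nat) (S::word) (B::nat \<Rightarrow> complex mat) (P::complex mat).
    1 \<le> k \<and>
    symmetric_word_equation 3 k S B P \<and>
    word_degree S = 6 \<and>
    (\<exists>X Y. X \<noteq> Y \<and>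
      is_solution 3 S B P X \<and> real_mat X \<and> positive_definite X \<and>
      is_solution 3 S B P Y \<and> real_mat Y \<and> positive_definite Y)"
proof -
  have B: "positive_definite (wit_B i)" "wit_B i \<in> carrier_mat 3 3" for i
    by (simp_all add: wit_B_def positive_definite_sym3)
  have P: "positive_semidefinite wit_P" "wit_P \<in> carrier_mat 3 3"
    unfolding wit_P_def
    by (simp_all add: positive_definite_imp_semidefinite positive_definite_sym3)
  let ?X = "sym3 6 0 0 6 0 6" and ?Y = "sym3 4 0 0 6 0 9"
  have XY: "positive_definite ?X" "positive_definite ?Y"
    by (simp_all add: positive_definite_sym3)
  have "?X $$ (0, 0) \<noteq> ?Y $$ (0, 0)" by simp
  then have "?X \<noteq> ?Y" by metis
  moreover have "symmetric_word_equation 3 3 wit_word wit_B wit_P"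
    using B P interlaced_wit_word
    by (simp add: symmetric_word_equation_def symmetric_word_def wit_word_def)
  moreover have "word_degree wit_word = 6"
    by (simp add: word_degree_def wit_word_def)
  moreover have "is_solution 3 wit_word wit_B wit_P ?X" "is_solution 3 wit_word wit_B wit_P ?Y"
    using XY by (simp_all add: is_solution_def positive_definite_imp_semidefinite
        word_mat_wit)
  moreover have "1 \<le> (3::nat)" by simp
  ultimately show ?thesis
    using XY real_mat_mat3 by blast
qed

end
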